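(* Let $(X,d)$ be a quasi-metric space that is $\alpha$-Ahlfors with measure $\mu$, and let $F\subseteq X$ be closed. Suppose that $(F,d)$ is $s$-Ahlfors with measure $\nu$, where $0\le s<\alpha$. Then $d(x,F)^{\gamma(s-\alpha)}\in A_1(X,d,\mu)$ for every $0\le\gamma<1$. Consequently, for $1<p<\infty$, $d(x,F)^{\beta}\in A_p(X,d,\mu)$ for every $\beta$ with $-(\alpha-s)<\beta<(\alpha-s)(p-1)$.
   Context: A quasi-distance on a set $X$ is a non-negative symmetric function $d$ on $X\times X$ with $d(x,y)=0$ iff $x=y$ and $d(x,y)\le K(d(x,z)+d(z,y))$ for all $x,y,z$, for some constant $K\ge1$ (the triangle constant). Balls are $B(x,r)=\{y\in X: d(x,y)<r\}$; they generate the topology of $X$, and it is assumed throughout that all balls are open sets. $\mathrm{diam}(E)=\sup\{d(x,y):x,y\in E\}$ and $d(x,E)=\inf\{d(x,y):y\in E\}$. A subspace $(Y,d)$ of a quasi-metric space $(X,d)$ is $\alpha$-Ahlfors with measure $\mu$ if $\mu$ is a (non-negative) Borel measure supported in $Y$, finite on balls, and there is a constant $c\ge1$ with $c^{-1}r^\alpha\le\mu(B(x,r))\le c\,r^\alpha$ for every $x\in Y$ and every $0<r<\mathrm{diam}(Y)$. The ambient $\alpha$-Ahlfors space $(X,d)$ with measure $\mu$ is regarded as a non-atomic space of homogeneous type (i.e. $0<\mu(B(x,2r))\le A\mu(B(x,r))<\infty$ for all $x,r$, and points have measure zero). A weight $w$ on $X$ is a non-negative function that is $\mu$-integrable over every ball.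 For $1<p<\infty$, $w\in A_p(X,d,\mu)$ means there is $C$ with $\left(\frac1{\mu(B)}\int_B w\,d\mu\right)\left(\frac1{\mu(B)}\int_B w^{-1/(p-1)}\,d\mu\right)^{p-1}\le C$ for every ball $B$; $w\in A_1(X,d,\mu)$ means there is $C$ with $\frac1{\mu(B)}\int_B w\,d\mu\le C\,w(x)$ for every ball $B$ and $\mu$-almost every $x\in B$. *)

theory Defs
  imports "HOL-Analysis.Analysis"
begin

section \<open>Quasi-metric spaces\<close>

definition quasi_distance :: "'a set \<Rightarrow> ('a \<Rightarrow> 'a \<Rightarrow> real) \<Rightarrow> bool" where
  "quasi_distance X d \<longleftrightarrow>
     (\<forall>x\<in>X. \<forall>y\<in>X. 0 \<le> d x y \<and> d x y = d y x \<and> (d x y = 0 \<longleftrightarrow> x = y)) \<and>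
     (\<exists>K\<ge>1. \<forall>x\<in>X. \<forall>y\<in>X. \<forall>z\<in>X. d x y \<le> K * (d x z + d z y))"

definition qball :: "'a set \<Rightarrow> ('a \<Rightarrow> 'a \<Rightarrow> real) \<Rightarrow> 'a \<Rightarrow> real \<Rightarrow> 'a set" where
  "qball X d x r = {y \<in> X. d x y < r}"

text \<open>A set is open iff it contains a ball around each of its points.  For a quasi-distance
  the balls need not be open in this topology; when they are, it is the topology generated
  by the balls (lemma \<open>qtopology_eq_generated\<close>).\<close>

definition qtopology :: "'a set \<Rightarrow> ('a \<Rightarrow> 'a \<Rightarrow> real) \<Rightarrow> 'a topology" where
  "qtopology X d = topology (\<lambda>U. U \<subseteq> X \<and> (\<forall>x\<in>U. \<exists>r>0. qball X d x r \<subseteq> U))"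

definition balls_open :: "'a set \<Rightarrow> ('a \<Rightarrow> 'a \<Rightarrow> real) \<Rightarrow> bool" where
  "balls_open X d \<longleftrightarrow> (\<forall>x\<in>X. \<forall>r>0. openin (qtopology X d) (qball X d x r))"

lemma openin_qtopology:
  "openin (qtopology X d) U \<longleftrightarrow> U \<subseteq> X \<and> (\<forall>x\<in>U. \<exists>r>0. qball X d x r \<subseteq> U)"
proof -
  let ?L = "\<lambda>U. U \<subseteq> X \<and> (\<forall>x\<in>U. \<exists>r>0. qball X d x r \<subseteq> U)"
  have "istopology ?L"
    unfolding istopology_def
  proof (intro conjI allI impI)
    fix S T assume S: "?L S" and T: "?L T"
    then show "S \<inter> T \<subseteq> X" by blast
    show "\<forall>x\<in>S \<inter> T. \<exists>r>0. qball X d x r \<subseteq> S \<inter> T"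
    proof
      fix x assume x: "x \<in> S \<inter> T"
      obtain r where r: "r > 0" "qball X d x r \<subseteq> S" using S x by blast
      obtain r' where r': "r' > 0" "qball X d x r' \<subseteq> T" using T x by blast
      have "qball X d x (min r r') \<subseteq> qball X d x r \<inter> qball X d x r'"
        by (auto simp: qball_def)
      with r r' show "\<exists>r>0. qball X d x r \<subseteq> S \<inter> T"
        by (intro exI[of _ "min r r'"]) auto
    qed
  next
    fix \<K> assume K: "\<forall>S\<in>\<K>. ?L S"
    then show "\<Union>\<K> \<subseteq> X" by blast
    show "\<forall>x\<in>\<Union>\<K>. \<exists>r>0. qball X d x r \<subseteq> \<Union>\<K>"
    proof
      fix x assume "x \<in> \<Union>\<K>"
      then obtain S where S: "S \<in> \<K>" "x \<in> S" by blast
      then obtain r where "r > 0" "qball X d x r \<subseteq> S" using K by blast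
      then show "\<exists>r>0. qball X d x r \<subseteq> \<Union>\<K>" using S by blast
    qed
  qed
  then show ?thesis
    unfolding qtopology_def by (simp add: topology_inverse')
qed

lemma topspace_qtopology [simp]: "topspace (qtopology X d) = X"
proof -
  have "openin (qtopology X d) X"
    by (auto simp: openin_qtopology qball_def intro!: exI[of _ "1::real"])
  then show ?thesis
    by (metis openin_qtopology openin_topspace openin_subset subset_antisym)
qed

lemma qtopology_eq_generated:
  assumes "quasi_distance X d" and "balls_open X d"
  shows "qtopology X d = topology_generated_by {qball X d x r |x r. x \<in> X \<and> 0 < r}"
proof -
  let ?B = "{qball X d x r |x r. x \<in> X \<and> 0 < r}"
  have "openin (qtopology X d) U \<longleftrightarrow> openin (topology_generated_by ?B) U" for U
  proof
    assume U: "openin (qtopology X d) U"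
    have "\<exists>T. openin (topology_generated_by ?B) T \<and> x \<in> T \<and> T \<subseteq> U" if x: "x \<in> U" for x
    proof -
      obtain r where r: "r > 0" "qball X d x r \<subseteq> U"
        using U x unfolding openin_qtopology by blast
      have xX: "x \<in> X" using U x unfolding openin_qtopology by blast
      have "openin (topology_generated_by ?B) (qball X d x r)"
        using r xX by (intro topology_generated_by_Basis) auto
      moreover have "x \<in> qball X d x r"
      proof -
        have "d x x = 0" using assms(1) xX unfolding quasi_distance_def by blast
        with r xX show ?thesis by (simp add: qball_def)
      qed
      ultimately show ?thesis using r by blast
    qed
    then show "openin (topology_generated_by ?B) U"
      by (subst openin_subopen) blast
  next
    assume "openin (topology_generated_by ?B) U"
    then have "generate_topology_on ?B U"
      by (simp add: openin_topology_generated_by_iff)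
    then show "openin (qtopology X d) U"
    proof induction
      case (UN K)
      then show ?case by (intro openin_Union) auto
    next
      case (Basis s)
      then show ?case using assms(2) by (auto simp: balls_open_def)
    qed auto
  qed
  then show ?thesis by (simp add: topology_eq)
qed

definition qdiam :: "('a \<Rightarrow> 'a \<Rightarrow> real) \<Rightarrow> 'a set \<Rightarrow> ereal" where
  "qdiam d E = (SUP x\<in>E. SUP y\<in>E. ereal (d x y))"

text \<open>Only meaningful for \<open>E \<noteq> {}\<close>.\<close>

definition qsetdist :: "('a \<Rightarrow> 'a \<Rightarrow> real) \<Rightarrow> 'a set \<Rightarrow> 'a \<Rightarrow> real" where
  "qsetdist d E x = (INF y\<in>E. d x y)"

section \<open>Borel measures, Ahlfors spaces and spaces of homogeneous type\<close>

definition borel_measure_on :: "'a set \<Rightarrow> ('a \<Rightarrow> 'a \<Rightarrow> real) \<Rightarrow> 'a measure \<Rightarrow> bool" where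
  "borel_measure_on X d \<mu> \<longleftrightarrow>
     space \<mu> = X \<and> sets \<mu> = sigma_sets X {U. openin (qtopology X d) U}"

text \<open>\<open>(Y, d)\<close>, as a subspace of \<open>(X, d)\<close>, is \<open>\<alpha>\<close>-Ahlfors with measure \<open>\<mu>\<close>.  The measure
  is a Borel measure on \<open>X\<close> carried by \<open>Y\<close>, so the \<open>\<mu>\<close>-measure of a ball of \<open>X\<close> centred in
  \<open>Y\<close> is that of the corresponding ball of \<open>Y\<close>.\<close>

definition ahlfors_in ::
  "'a set \<Rightarrow> ('a \<Rightarrow> 'a \<Rightarrow> real) \<Rightarrow> 'a set \<Rightarrow> real \<Rightarrow> 'a measure \<Rightarrow> bool" where
  "ahlfors_in X d Y \<alpha> \<mu> \<longleftrightarrow>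
     Y \<subseteq> X \<and>
     borel_measure_on X d \<mu> \<and>
     X - Y \<in> null_sets \<mu> \<and>
     (\<forall>x\<in>X. \<forall>r>0. emeasure \<mu> (qball X d x r) < \<infinity>) \<and>
     (\<exists>c\<ge>1. \<forall>x\<in>Y. \<forall>r>0. ereal r < qdiam d Y \<longrightarrow>
        ennreal (inverse c * r powr \<alpha>) \<le> emeasure \<mu> (qball X d x r) \<and>
        emeasure \<mu> (qball X d x r) \<le> ennreal (c * r powr \<alpha>))"

definition homogeneous_type :: "'a set \<Rightarrow> ('a \<Rightarrow> 'a \<Rightarrow> real) \<Rightarrow> 'a measure \<Rightarrow> bool" where
  "homogeneous_type X d \<mu> \<longleftrightarrow>
     borel_measure_on X d \<mu> \<and>
     (\<exists>A::real. \<forall>x\<in>X. \<forall>r>0.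
        0 < emeasure \<mu> (qball X d x (2 * r)) \<and>
        emeasure \<mu> (qball X d x (2 * r)) \<le> ennreal A * emeasure \<mu> (qball X d x r) \<and>
        emeasure \<mu> (qball X d x r) < \<infinity>)"

definition non_atomic :: "'a set \<Rightarrow> 'a measure \<Rightarrow> bool" where
  "non_atomic X \<mu> \<longleftrightarrow> (\<forall>x\<in>X. {x} \<in> null_sets \<mu>)"

section \<open>Muckenhoupt weights\<close>

text \<open>Real powers of elements of \<open>[0, \<infinity>]\<close>, with \<open>t\<^sup>0 = 1\<close> and, unlike for \<open>powr\<close> on the reals,
  \<open>0\<^sup>a = \<infinity>\<close> for \<open>a < 0\<close>.  Weights take values in \<open>[0, \<infinity>]\<close>, so that a negative power of the
  distance to a set is infinite on that set.\<close>

definition epow :: "ennreal \<Rightarrow> real \<Rightarrow> ennreal" where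
  "epow t a =
     (if a = 0 then 1
      else if t = \<infinity> then (if a > 0 then \<infinity> else 0)
      else if t = 0 then (if a > 0 then 0 else \<infinity>)
      else ennreal (enn2real t powr a))"

definition weight ::
  "'a set \<Rightarrow> ('a \<Rightarrow> 'a \<Rightarrow> real) \<Rightarrow> 'a measure \<Rightarrow> ('a \<Rightarrow> ennreal) \<Rightarrow> bool" where
  "weight X d \<mu> w \<longleftrightarrow>
     w \<in> borel_measurable \<mu> \<and>
     (\<forall>x\<in>X. \<forall>r>0. (\<integral>\<^sup>+y\<in>qball X d x r. w y \<partial>\<mu>) < \<infinity>)"

definition average :: "'a measure \<Rightarrow> 'a set \<Rightarrow> ('a \<Rightarrow> ennreal) \<Rightarrow> ennreal" where
  "average \<mu> B f = (\<integral>\<^sup>+y\<in>B. f y \<partial>\<mu>) / emeasure \<mu> B"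

text \<open>The product of the two averages is taken in \<open>[0, \<infinity>]\<close>, where \<open>0 * \<infinity> = 0\<close>.  This
  convention only matters for a weight vanishing almost everywhere on some ball.\<close>

definition muckenhoupt_Ap ::
  "real \<Rightarrow> 'a set \<Rightarrow> ('a \<Rightarrow> 'a \<Rightarrow> real) \<Rightarrow> 'a measure \<Rightarrow> ('a \<Rightarrow> ennreal) \<Rightarrow> bool" where
  "muckenhoupt_Ap p X d \<mu> w \<longleftrightarrow>
     weight X d \<mu> w \<and>
     (\<exists>C::real. \<forall>x\<in>X. \<forall>r>0.
        average \<mu> (qball X d x r) w *
        epow (average \<mu> (qball X d x r) (\<lambda>y. epow (w y) (- 1 / (p - 1)))) (p - 1) \<le> ennreal C)"

definition muckenhoupt_A1 ::
  "'a set \<Rightarrow> ('a \<Rightarrow> 'a \<Rightarrow> real) \<Rightarrow> 'a measure \<Rightarrow> ('a \<Rightarrow> ennreal) \<Rightarrow> bool" where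
  "muckenhoupt_A1 X d \<mu> w \<longleftrightarrow>
     weight X d \<mu> w \<and>
     (\<exists>C::real. \<forall>x\<in>X. \<forall>r>0.
        AE y in \<mu>. y \<in> qball X d x r \<longrightarrow> average \<mu> (qball X d x r) w \<le> ennreal C * w y)"

end

theory Submission
  imports Defs
begin

text \<open>
  Everything follows from one estimate.  Write \<open>f\<close> for the distance to \<open>F\<close>, and attach to a ball
  \<open>B = B(x, r)\<close> the length \<open>\<rho> = f x + r\<close>.  For every exponent \<open>b > s - \<alpha>\<close>, the average of \<open>f\<^sup>b\<close>
  over \<open>B\<close> is at most \<open>C \<rho>\<^sup>b\<close>, with \<open>C\<close> independent of the ball (\<open>distance_power_integral\<close>).
  Since \<open>f \<le> K \<rho>\<close> on \<open>B\<close>, for \<open>b \<le> 0\<close> the bound \<open>\<rho>\<^sup>b\<close> is at most a multiple of \<open>f\<^sup>b\<close> on \<open>B\<close>, which is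
  the \<open>A\<^sub>1\<close> condition.  For \<open>A\<^sub>p\<close> the estimate is used for the two exponents \<open>\<beta>\<close> and
  \<open>- \<beta> / (p - 1)\<close>: that both exceed \<open>s - \<alpha>\<close> is exactly the assumed range of \<open>\<beta>\<close>, and in the
  product of the two averages the powers of \<open>\<rho>\<close> cancel, because both are controlled by the same \<open>\<rho>\<close>.

  The estimate is immediate when \<open>b \<ge> 0\<close>, and also when \<open>B\<close> is far from \<open>F\<close> compared with its
  radius, for then \<open>f\<close> is comparable to \<open>\<rho>\<close> on all of \<open>B\<close>.  There remain \<open>b < 0\<close> and balls contained in
  some \<open>B(z, R)\<close> with \<open>z \<in> F\<close> and \<open>R\<close> comparable to \<open>r\<close>.  Comparing \<open>\<nu>\<close>-measures, an
  \<open>\<epsilon>\<close>-separated subset of \<open>F \<inter> B(z, R)\<close> has at most \<open>C (R / \<epsilon>)\<^sup>s\<close> points (\<open>ahlfors_packing\<close>).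
  Balls of radius about \<open>\<epsilon>\<close> around a maximal such set cover the tube \<open>{f < \<epsilon>}\<close> in \<open>B(z, R)\<close>,
  whose \<open>\<mu>\<close>-measure is therefore at most \<open>C \<epsilon>\<^sup>\<alpha> (R / \<epsilon>)\<^sup>s\<close> (\<open>tube_measure\<close>).  Summing over
  the dyadic layers of \<open>f\<close> gives a geometric series, convergent because \<open>\<alpha> - s + b > 0\<close>
  (\<open>negative_power_integral\<close>).

  The regularity bounds are only given for radii below the diameter.  The upper bounds extend to all
  radii; the lower bound for \<open>\<mu>\<close> need not, but each ball equals one whose radius satisfies it.
\<close>

section \<open>Extended powers\<close>

lemma epow_ennreal: "0 < t \<Longrightarrow> epow (ennreal t) a = ennreal (t powr a)"
  by (simp add: epow_def)

lemma epow_epow: "epow (epow t a) b = epow t (a * b)"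
proof -
  consider "a = 0" | "t = \<infinity>" | "t = 0" | u where "0 < u" "t = ennreal u"
    by (cases t) (auto simp: less_le)
  then show ?thesis
  proof cases
    case 4
    then show ?thesis by (simp add: epow_ennreal powr_powr)
  qed (auto simp: epow_def mult_less_0_iff zero_less_mult_iff)
qed

lemma epow_le_nonneg: "\<lbrakk>t \<le> u; 0 < u; 0 \<le> b\<rbrakk> \<Longrightarrow> epow (ennreal t) b \<le> ennreal (u powr b)"
  by (cases "0 < t") (auto simp: epow_ennreal ennreal_neg epow_def intro!: ennreal_leI powr_mono2)

lemma epow_le_ennreal:
  assumes "t \<le> ennreal u" "0 < u" "0 \<le> b"
  shows "epow t b \<le> ennreal (u powr b)"
proof (cases t)
  case (real v)
  then show ?thesis using assms epow_le_nonneg[of v u b] by (simp add: ennreal_le_iff)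
qed (use assms in \<open>simp add: top_unique\<close>)

lemma epow_le_nonpos: "\<lbrakk>u \<le> t; 0 < u; b \<le> 0\<rbrakk> \<Longrightarrow> epow (ennreal t) b \<le> ennreal (u powr b)"
  by (auto simp: epow_ennreal intro!: ennreal_leI powr_mono2')

lemma le_epow_nonpos: "\<lbrakk>t \<le> u; 0 < u; b \<le> 0\<rbrakk> \<Longrightarrow> ennreal (u powr b) \<le> epow (ennreal t) b"
  by (cases "0 < t") (auto simp: epow_ennreal ennreal_neg epow_def intro!: ennreal_leI powr_mono2')

lemma epow_measurable [measurable]:
  assumes [measurable]: "f \<in> borel_measurable M"
  shows "(\<lambda>x. epow (f x) a) \<in> borel_measurable M"
  unfolding epow_def by measurable

lemma suminf_const_ennreal: "0 < c \<Longrightarrow> (\<Sum>k::nat. c) = (\<infinity>::ennreal)"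
  by (subst nn_integral_count_space_nat[symmetric]) (simp add: ennreal_mult_top)

text \<open>
  The integral of \<open>f\<^sup>b\<close> is dominated by the sum over \<open>k\<close> of \<open>(R / 2\<^sup>k\<^sup>+\<^sup>1)\<^sup>b\<close> times the measure of the
  sublevel set \<open>{f < R / 2\<^sup>k}\<close>, a geometric series with ratio \<open>2\<close> to the power \<open>- (\<delta> + b)\<close>.  Using
  sublevel sets in place of the layers between them costs only a constant, and covers the points with
  \<open>f = 0\<close> without separate treatment: they lie in every sublevel set, and the sum of all the
  coefficients is infinite.
\<close>

lemma negative_power_integral:
  assumes f: "f \<in> borel_measurable M" and B: "B \<in> sets M"
    and small: "\<And>\<epsilon>. \<lbrakk>0 < \<epsilon>; \<epsilon> \<le> R\<rbrakk> \<Longrightarrow> emeasure M {y \<in> B. f y < \<epsilon>} \<le> ennreal (T * \<epsilon> powr \<delta>)"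
    and less: "\<And>y. y \<in> B \<Longrightarrow> f y < R"
    and T: "0 \<le> T" and R: "0 < R" and b: "b < 0" "0 < \<delta> + b"
  shows "(\<integral>\<^sup>+y\<in>B. epow (ennreal (f y)) b \<partial>M)
     \<le> ennreal (T * (2 powr - b / (1 - 2 powr - (\<delta> + b))) * R powr (\<delta> + b))"
proof -
  define E where "E k = {y \<in> B. f y < R / 2 ^ k}" for k :: nat
  define c where "c k = (R / 2 ^ Suc k) powr b" for k :: nat
  define q :: real where "q = 2 powr - (\<delta> + b)"
  have q: "0 < q" "q < 1" using b powr_less_mono[of "- (\<delta> + b)" 0 2] by (auto simp: q_def)
  have E_sets: "E k \<in> sets M" for k
  proof -
    have "E k = B \<inter> {y \<in> space M. f y < R / 2 ^ k}"
      using sets.sets_into_space[OF B] by (auto simp: E_def)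
    then show ?thesis using f B by simp
  qed
  have "epow (ennreal (f y)) b \<le> (\<Sum>k. ennreal (c k) * indicator (E k) y)" if y: "y \<in> B" for y
  proof (cases "0 < f y")
    case True
    obtain n0 where "R / f y < 2 ^ n0" using real_arch_pow[of 2 "R / f y"] by auto
    then have ex: "R / 2 ^ n0 \<le> f y" using True by (simp add: field_simps)
    \<comment> \<open>The layer containing \<open>y\<close>: \<open>n\<close> is positive because \<open>f y < R\<close>, and \<open>y\<close> lies in layer \<open>n - 1\<close>.\<close>
    define n where "n = (LEAST n. R / 2 ^ n \<le> f y)"
    have n: "R / 2 ^ n \<le> f y" unfolding n_def using ex by (rule LeastI)
    then have "n \<noteq> 0" using less[OF y] by (intro notI) simp
    then obtain k where k: "n = Suc k" using not0_implies_Suc by blast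
    have "f y < R / 2 ^ k"
      using not_less_Least[of k "\<lambda>n. R / 2 ^ n \<le> f y"] k by (simp add: n_def)
    then have yk: "y \<in> E k" using y by (simp add: E_def)
    have "epow (ennreal (f y)) b \<le> ennreal (c k)"
      using n R b unfolding k c_def by (intro epow_le_nonpos) auto
    also have "\<dots> = (\<Sum>k\<in>{k}. ennreal (c k) * indicator (E k) y)" using yk by simp
    also have "\<dots> \<le> (\<Sum>k. ennreal (c k) * indicator (E k) y)"
      by (intro sum_le_suminf summableI) auto
    finally show ?thesis .
  next
    case False
    have "ennreal (c 0) \<le> ennreal (c k) * indicator (E k) y" for k
    proof -
      have "0 < R / 2 ^ k" using R by simp
      then have "f y < R / 2 ^ k" using False by linarith
      then have "y \<in> E k" using y by (simp add: E_def)
      moreover have "c 0 \<le> c k"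
        using R b unfolding c_def by (intro powr_mono2') (auto simp: field_simps)
      ultimately show ?thesis by (simp add: ennreal_leI)
    qed
    then have "(\<Sum>k::nat. ennreal (c 0)) \<le> (\<Sum>k. ennreal (c k) * indicator (E k) y)"
      by (intro suminf_le summableI) auto
    moreover have "0 < ennreal (c 0)" using R by (simp add: c_def)
    ultimately show ?thesis using suminf_const_ennreal by (simp add: top_unique)
  qed
  then have "(\<integral>\<^sup>+y\<in>B. epow (ennreal (f y)) b \<partial>M)
      \<le> (\<integral>\<^sup>+y. (\<Sum>k. ennreal (c k) * indicator (E k) y) \<partial>M)"
    by (intro nn_integral_mono) (auto simp: indicator_def)
  also have "\<dots> = (\<Sum>k. ennreal (c k) * emeasure M (E k))"
    using E_sets by (subst nn_integral_suminf) (auto simp: nn_integral_cmult_indicator)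
  also have "\<dots> \<le> (\<Sum>k. ennreal (T * 2 powr - b * R powr (\<delta> + b) * q ^ k))"
  proof (intro suminf_le summableI)
    fix k
    have Rk: "0 < R / 2 ^ k" "R / 2 ^ k \<le> R"
      using R by (auto simp: divide_le_eq mult_le_cancel_left1)
    have "ennreal (c k) * emeasure M (E k) \<le> ennreal (c k) * ennreal (T * (R / 2 ^ k) powr \<delta>)"
      using small[OF Rk] by (intro mult_left_mono) (auto simp: E_def)
    also have "\<dots> = ennreal (c k * (T * (R / 2 ^ k) powr \<delta>))"
      using T by (subst ennreal_mult) (auto simp: c_def)
    also have "c k * (T * (R / 2 ^ k) powr \<delta>)
        = (R / 2 ^ k) powr b * 2 powr - b * (T * (R / 2 ^ k) powr \<delta>)"
    proof -
      have "c k = ((R / 2 ^ k) / 2) powr b" by (simp add: c_def field_simps)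
      then show ?thesis using R by (simp only: powr_divide powr_minus_divide) simp
    qed
    also have "(R / 2 ^ k) powr b * 2 powr - b * (T * (R / 2 ^ k) powr \<delta>)
        = T * 2 powr - b * (R / 2 ^ k) powr (\<delta> + b)"
      by (simp add: powr_add)
    also have "(R / 2 ^ k) powr (\<delta> + b) = R powr (\<delta> + b) * q ^ k"
    proof -
      have "q ^ k = (2 ^ k) powr - (\<delta> + b)"
        by (simp add: q_def powr_powr powr_realpow[symmetric] mult.commute)
      then show ?thesis using R by (simp add: powr_divide powr_minus_divide del: minus_add_distrib)
    qed
    finally show "ennreal (c k) * emeasure M (E k)
        \<le> ennreal (T * 2 powr - b * R powr (\<delta> + b) * q ^ k)"
      by (simp add: mult.assoc)
  qed
  also have "\<dots> = ennreal (T * 2 powr - b * R powr (\<delta> + b) * (1 / (1 - q)))"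
    using q T by (intro suminf_ennreal_eq sums_mult geometric_sums) auto
  also have "T * 2 powr - b * R powr (\<delta> + b) * (1 / (1 - q))
      = T * (2 powr - b / (1 - 2 powr - (\<delta> + b))) * R powr (\<delta> + b)"
    by (simp add: q_def)
  finally show ?thesis .
qed


section \<open>Geometry of a quasi-metric space\<close>

locale quasi_metric =
  fixes X :: "'a set" and d :: "'a \<Rightarrow> 'a \<Rightarrow> real" and K :: real
  assumes nonneg: "\<lbrakk>x \<in> X; y \<in> X\<rbrakk> \<Longrightarrow> 0 \<le> d x y"
    and sym: "\<lbrakk>x \<in> X; y \<in> X\<rbrakk> \<Longrightarrow> d x y = d y x"
    and zero_iff: "\<lbrakk>x \<in> X; y \<in> X\<rbrakk> \<Longrightarrow> d x y = 0 \<longleftrightarrow> x = y"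
    and K_ge_1: "1 \<le> K"
    and triangle: "\<lbrakk>x \<in> X; y \<in> X; z \<in> X\<rbrakk> \<Longrightarrow> d x y \<le> K * (d x z + d z y)"
    and balls_open: "balls_open X d"
begin

lemma triangle_less:
  assumes "x \<in> X" "y \<in> X" "z \<in> X" "d x z < a" "d z y < b"
  shows "d x y < K * (a + b)"
proof -
  have "d x y \<le> K * (d x z + d z y)" using assms triangle by blast
  also have "\<dots> < K * (a + b)" using K_ge_1 assms by (intro mult_strict_left_mono) auto
  finally show ?thesis .
qed

lemma qball_sets:
  assumes "borel_measure_on X d M" "x \<in> X" "r > 0"
  shows "qball X d x r \<in> sets M"
  using assms balls_open unfolding borel_measure_on_def balls_open_def
  by (auto intro: sigma_sets.Basic)

lemma le_qdiam: "\<lbrakk>x \<in> E; y \<in> E\<rbrakk> \<Longrightarrow> ereal (d x y) \<le> qdiam d E"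
  unfolding qdiam_def by (meson SUP_upper2 order_refl)

lemma qball_eq_space:
  assumes "qdiam d X = ereal D" "x \<in> X" "D < r"
  shows "qball X d x r = X"
  using assms le_qdiam[of x X] by (force simp: qball_def)

lemma qsetdist_le: "\<lbrakk>F \<subseteq> X; x \<in> X; z \<in> F\<rbrakk> \<Longrightarrow> qsetdist d F x \<le> d x z"
  unfolding qsetdist_def
  by (rule cINF_lower) (auto intro!: bdd_belowI[where m = 0] nonneg)

lemma qsetdist_less_iff:
  assumes "F \<subseteq> X" "F \<noteq> {}" "x \<in> X"
  shows "qsetdist d F x < t \<longleftrightarrow> (\<exists>z\<in>F. d x z < t)"
proof -
  have "bdd_below (d x ` F)"
    using assms by (auto intro!: bdd_belowI[where m = 0] nonneg)
  then show ?thesis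
    unfolding qsetdist_def using assms by (simp add: cInf_less_iff)
qed

lemma qsetdist_nonneg:
  assumes "F \<subseteq> X" "F \<noteq> {}" "x \<in> X"
  shows "0 \<le> qsetdist d F x"
  unfolding qsetdist_def using assms by (intro cINF_greatest nonneg) auto

lemma qsetdist_quasi_lipschitz:
  assumes F: "F \<subseteq> X" "F \<noteq> {}" and xy: "x \<in> X" "y \<in> X"
  shows "qsetdist d F y \<le> K * (d y x + qsetdist d F x)"
proof (rule ccontr)
  assume "\<not> ?thesis"
  then have "qsetdist d F x < qsetdist d F y / K - d y x"
    using K_ge_1 by (simp add: field_simps)
  then obtain z where z: "z \<in> F" "d x z < qsetdist d F y / K - d y x"
    using qsetdist_less_iff F xy by blast
  have "qsetdist d F y \<le> K * (d y x + d x z)"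
    using qsetdist_le[OF F(1) xy(2) z(1)] triangle[of y z x] F z xy by force
  also have "\<dots> < qsetdist d F y"
    using z(2) K_ge_1 by (simp add: field_simps)
  finally show False by simp
qed

text \<open>Sublevel sets of the distance to \<open>F\<close> are unions of balls centred in \<open>F\<close>, hence open.\<close>

lemma qsetdist_measurable:
  assumes M: "borel_measure_on X d M" and F: "F \<subseteq> X" "F \<noteq> {}"
  shows "qsetdist d F \<in> borel_measurable M"
proof (subst borel_measurable_iff_less, intro allI)
  fix t
  have sp: "space M = X" using M by (simp add: borel_measure_on_def)
  have "qsetdist d F x < t \<longleftrightarrow> 0 < t \<and> (\<exists>z\<in>F. d z x < t)" if "x \<in> X" for x
    using qsetdist_less_iff[OF F that] qsetdist_nonneg[OF F that] sym[OF that] F(1)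
    by (metis le_less_trans subsetD)
  then have eq: "{x \<in> space M. qsetdist d F x < t} = (if t > 0 then (\<Union>z\<in>F. qball X d z t) else {})"
    unfolding sp qball_def by auto
  have "openin (qtopology X d) (\<Union>z\<in>F. qball X d z t)" if "t > 0"
    using that F balls_open unfolding balls_open_def by (intro openin_Union) auto
  then show "{x \<in> space M. qsetdist d F x < t} \<in> sets M"
    using M unfolding eq borel_measure_on_def by (auto intro: sigma_sets.Basic sigma_sets.Empty)
qed


section \<open>Ahlfors regularity beyond the diameter\<close>

text \<open>
  At radii at least the diameter \<open>D\<close> of \<open>Y\<close>, a ball carries no more than the whole of \<open>Y\<close>, whose measure is
  finite, being that of a ball of radius \<open>2 D\<close> up to a null set; and \<open>r\<^sup>\<alpha> \<ge> D\<^sup>\<alpha>\<close>.  A one-point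
  \<open>Y\<close> is excluded: \<open>D\<^sup>\<alpha>\<close> may then vanish, and nothing bounds the measure at small radii.
\<close>

lemma ahlfors_upper:
  assumes A: "ahlfors_in X d Y \<alpha> M" and \<alpha>: "0 \<le> \<alpha>" and diam: "0 < qdiam d Y"
  obtains C where "0 < C"
    "\<And>x r. \<lbrakk>x \<in> Y; 0 < r\<rbrakk> \<Longrightarrow> emeasure M (qball X d x r) \<le> ennreal (C * r powr \<alpha>)"
proof -
  have YX: "Y \<subseteq> X" and B: "borel_measure_on X d M" and null: "X - Y \<in> null_sets M"
    and fin: "\<And>x r. \<lbrakk>x \<in> X; 0 < r\<rbrakk> \<Longrightarrow> emeasure M (qball X d x r) < \<infinity>"
    using A by (auto simp: ahlfors_in_def)
  obtain c where c: "c \<ge> 1" "\<And>x r. \<lbrakk>x \<in> Y; 0 < r; ereal r < qdiam d Y\<rbrakk> \<Longrightarrow>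
      emeasure M (qball X d x r) \<le> ennreal (c * r powr \<alpha>)"
    using A unfolding ahlfors_in_def by blast
  show ?thesis
  proof (cases "qdiam d Y = \<infinity>")
    case True
    then show ?thesis using c by (intro that[of c]) auto
  next
    case False
    then obtain D where D: "qdiam d Y = ereal D" "D > 0" using diam by (cases "qdiam d Y") auto
    obtain y0 where y0: "y0 \<in> Y"
      using diam by (cases "Y = {}") (auto simp: qdiam_def bot_ereal_def)
    define m where "m = enn2real (emeasure M (qball X d y0 (2 * D)))"
    have m: "emeasure M (qball X d y0 (2 * D)) = ennreal m"
      using fin[of y0 "2 * D"] y0 YX D by (auto simp: m_def less_top)
    have m0: "0 \<le> m" by (simp add: m_def)
    define C where "C = c + m / D powr \<alpha>"
    have "emeasure M (qball X d x r) \<le> ennreal (C * r powr \<alpha>)" if x: "x \<in> Y" "0 < r" for x r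
    proof (cases "r < D")
      case True
      have "emeasure M (qball X d x r) \<le> ennreal (c * r powr \<alpha>)"
        using c True x D by auto
      also have "\<dots> \<le> ennreal (C * r powr \<alpha>)"
        using m0 by (intro ennreal_leI mult_right_mono) (auto simp: C_def)
      finally show ?thesis .
    next
      case False
      have "d y0 y < 2 * D" if "y \<in> Y" for y
        using le_qdiam[OF y0 that] D by auto
      then have "qball X d x r \<subseteq> qball X d y0 (2 * D) \<union> (X - Y)"
        using YX by (auto simp: qball_def)
      then have "emeasure M (qball X d x r) \<le> emeasure M (qball X d y0 (2 * D) \<union> (X - Y))"
        using null y0 YX D by (intro emeasure_mono sets.Un qball_sets[OF B]) auto
      also have "\<dots> = ennreal m"
        using null y0 YX D m by (subst emeasure_Un_null_set) (auto intro!: qball_sets[OF B])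
      also have "\<dots> \<le> ennreal (C * r powr \<alpha>)"
      proof (rule ennreal_leI)
        have "m = m / D powr \<alpha> * D powr \<alpha>" using D by simp
        also have "\<dots> \<le> C * r powr \<alpha>"
          using False D \<alpha> m0 c by (intro mult_mono powr_mono2) (auto simp: C_def)
        finally show "m \<le> C * r powr \<alpha>" .
      qed
      finally show ?thesis .
    qed
    moreover have "C > 0" using c m0 by (simp add: C_def add_pos_nonneg)
    ultimately show ?thesis using that by blast
  qed
qed

text \<open>
  In a bounded space the mass of balls stops growing, so the lower bound may fail for large radii; but
  a ball of radius larger than \<open>2 D\<close>, with \<open>D\<close> the diameter, is the whole space and equals the ball of
  radius \<open>2 D\<close>.  At radii between \<open>D\<close> and \<open>2 D\<close> the bound at \<open>D / 2\<close> is good enough.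
\<close>

lemma ahlfors_lower_same_ball:
  assumes A: "ahlfors_in X d X \<alpha> M" and \<alpha>: "0 \<le> \<alpha>" and diam: "0 < qdiam d X"
  obtains c where "0 < c" "\<And>x r. \<lbrakk>x \<in> X; 0 < r\<rbrakk> \<Longrightarrow>
     \<exists>r'>0. qball X d x r = qball X d x r' \<and> ennreal (c * r' powr \<alpha>) \<le> emeasure M (qball X d x r')"
proof -
  have B: "borel_measure_on X d M" using A by (auto simp: ahlfors_in_def)
  obtain c where c: "c \<ge> 1" "\<And>x r. \<lbrakk>x \<in> X; 0 < r; ereal r < qdiam d X\<rbrakk> \<Longrightarrow>
      ennreal (inverse c * r powr \<alpha>) \<le> emeasure M (qball X d x r)"
    using A unfolding ahlfors_in_def by blast
  define c' where "c' = inverse c * (1/4) powr \<alpha>"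
  have c': "c' > 0" "c' \<le> inverse c"
    using c \<alpha> powr_mono2[of \<alpha> "1/4" 1] by (auto simp: c'_def mult_le_cancel_left1)
  have "\<exists>r'>0. qball X d x r = qball X d x r' \<and>
      ennreal (c' * r' powr \<alpha>) \<le> emeasure M (qball X d x r')" if x: "x \<in> X" "0 < r" for x r
  proof (cases "ereal r < qdiam d X")
    case True
    have "ennreal (c' * r powr \<alpha>) \<le> ennreal (inverse c * r powr \<alpha>)"
      using c' by (intro ennreal_leI mult_right_mono) auto
    also have "\<dots> \<le> emeasure M (qball X d x r)" using c x True by blast
    finally show ?thesis using x by blast
  next
    case False
    then obtain D where D: "qdiam d X = ereal D" "D > 0" using diam by (cases "qdiam d X") auto
    define r' where "r' = min r (2 * D)"
    have r': "r' > 0" "D / 2 \<le> r'" "r' / 4 \<le> D / 2" using False D x by (auto simp: r'_def)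
    have "qball X d x r = qball X d x r'"
      using qball_eq_space[OF D(1) x(1)] D by (cases "r \<le> 2 * D") (auto simp: r'_def)
    moreover have "ennreal (c' * r' powr \<alpha>) \<le> emeasure M (qball X d x r')"
    proof -
      have "c' * r' powr \<alpha> = inverse c * (r' / 4) powr \<alpha>"
        using powr_mult[of "1/4" r' \<alpha>] r' by (simp add: c'_def)
      also have "\<dots> \<le> inverse c * (D / 2) powr \<alpha>"
        using c r' \<alpha> by (intro mult_left_mono powr_mono2) auto
      finally have "ennreal (c' * r' powr \<alpha>) \<le> ennreal (inverse c * (D / 2) powr \<alpha>)"
        by (rule ennreal_leI)
      also have "\<dots> \<le> emeasure M (qball X d x (D / 2))" using c D x by auto
      also have "\<dots> \<le> emeasure M (qball X d x r')"
        using r' x by (intro emeasure_mono qball_sets[OF B]) (auto simp: qball_def)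
      finally show ?thesis .
    qed
    ultimately show ?thesis using r' by blast
  qed
  with c' that show ?thesis by blast
qed


section \<open>Packing and tubular neighbourhoods\<close>

definition separated :: "real \<Rightarrow> 'a set \<Rightarrow> bool" where
  "separated \<epsilon> S \<longleftrightarrow> finite S \<and> (\<forall>u\<in>S. \<forall>v\<in>S. u \<noteq> v \<longrightarrow> \<epsilon> \<le> d u v)"

text \<open>
  The balls of radius \<open>\<epsilon> / (2 K)\<close> around the points of \<open>S\<close> are disjoint and contained in
  \<open>B(x, 2 K r)\<close>; comparing measures bounds their number.  The lower bound on the measure is
  available at this radius as soon as \<open>S\<close> has two points, since then \<open>\<epsilon>\<close> is at most the diameter
  of \<open>F\<close>.  If \<open>F\<close> is a single point the regularity hypothesis says nothing about small balls, but
  then \<open>S\<close> has at most one point.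
\<close>

lemma ahlfors_packing:
  assumes A: "ahlfors_in X d F s N" and s: "0 \<le> s"
  obtains C where "1 \<le> C"
    "\<And>x r \<epsilon> S. \<lbrakk>x \<in> F; 0 < \<epsilon>; \<epsilon> \<le> r; S \<subseteq> F \<inter> qball X d x r; separated \<epsilon> S\<rbrakk> \<Longrightarrow>
       real (card S) \<le> C * (r / \<epsilon>) powr s"
proof (cases "0 < qdiam d F")
  case True
  have FX: "F \<subseteq> X" and B: "borel_measure_on X d N"
    using A by (auto simp: ahlfors_in_def)
  obtain c where c: "c \<ge> 1" "\<And>x r. \<lbrakk>x \<in> F; 0 < r; ereal r < qdiam d F\<rbrakk> \<Longrightarrow>
      ennreal (inverse c * r powr s) \<le> emeasure N (qball X d x r)"
    using A unfolding ahlfors_in_def by blast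
  obtain C1 where C1: "C1 > 0" "\<And>x r. \<lbrakk>x \<in> F; 0 < r\<rbrakk> \<Longrightarrow>
      emeasure N (qball X d x r) \<le> ennreal (C1 * r powr s)"
    using ahlfors_upper[OF A s True] by blast
  define C where "C = max 1 (c * C1 * (4 * K\<^sup>2) powr s)"
  have "real (card S) \<le> C * (r / \<epsilon>) powr s"
    if x: "x \<in> F" and \<epsilon>: "0 < \<epsilon>" "\<epsilon> \<le> r" and S: "S \<subseteq> F \<inter> qball X d x r" and sep: "separated \<epsilon> S"
    for x r \<epsilon> S
  proof (cases "\<exists>u\<in>S. \<exists>v\<in>S. u \<noteq> v")
    case False
    then have "card S \<le> 1" using sep by (auto simp: separated_def card_le_Suc0_iff_eq)
    moreover have "1 \<le> C * (r / \<epsilon>) powr s"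
      using mult_mono[of 1 C 1 "(r / \<epsilon>) powr s"] \<epsilon> s by (auto simp: C_def ge_one_powr_ge_zero)
    ultimately show ?thesis by linarith
  next
    case True
    define \<delta> where "\<delta> = \<epsilon> / (2 * K)"
    have \<delta>: "0 < \<delta>" "\<delta> < \<epsilon>" "2 * K * \<delta> = \<epsilon>"
      using \<epsilon> K_ge_1 by (auto simp: \<delta>_def field_simps)
    obtain u v where "u \<in> S" "v \<in> S" "u \<noteq> v" using True by blast
    then have "ereal \<epsilon> \<le> qdiam d F"
      using sep S le_qdiam[of u F v] order_trans[of "ereal \<epsilon>" "ereal (d u v)" "qdiam d F"]
      by (auto simp: separated_def)
    with \<delta> have \<delta>D: "ereal \<delta> < qdiam d F" by (metis less_ereal.simps(1) less_le_trans)
    have SX: "S \<subseteq> X" "S \<subseteq> F" using S FX by auto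
    have fin: "finite S" using sep by (simp add: separated_def)
    have disj: "disjoint_family_on (\<lambda>v. qball X d v \<delta>) S"
    proof (clarsimp simp: disjoint_family_on_def)
      fix u v assume uv: "u \<in> S" "v \<in> S" "u \<noteq> v"
      have False if y: "y \<in> qball X d u \<delta>" "y \<in> qball X d v \<delta>" for y
      proof -
        have "d u v < K * (\<delta> + \<delta>)"
          using y uv SX sym by (intro triangle_less[where z = y]) (auto simp: qball_def)
        also have "\<dots> = \<epsilon>" using \<delta>(3) by simp
        finally show False using sep uv by (force simp: separated_def)
      qed
      then show "qball X d u \<delta> \<inter> qball X d v \<delta> = {}" by blast
    qed
    have sub: "(\<Union>v\<in>S. qball X d v \<delta>) \<subseteq> qball X d x (2 * K * r)"
    proof clarify
      fix v y assume v: "v \<in> S" and y: "y \<in> qball X d v \<delta>"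
      have "d x y < K * (r + \<delta>)"
        using v y SX S x FX by (intro triangle_less[where z = v]) (auto simp: qball_def)
      also have "\<dots> \<le> K * (r + r)" using \<delta> \<epsilon> K_ge_1 by (intro mult_left_mono) auto
      finally show "y \<in> qball X d x (2 * K * r)" using y by (auto simp: qball_def)
    qed
    have "ennreal (real (card S) * (inverse c * \<delta> powr s)) = (\<Sum>v\<in>S. ennreal (inverse c * \<delta> powr s))"
      using c by (simp add: ennreal_mult ennreal_of_nat_eq_real_of_nat)
    also have "\<dots> \<le> (\<Sum>v\<in>S. emeasure N (qball X d v \<delta>))"
      using c SX \<delta>D \<delta> by (intro sum_mono) auto
    also have "\<dots> = emeasure N (\<Union>v\<in>S. qball X d v \<delta>)"
      using fin disj \<delta> SX by (intro sum_emeasure) (auto intro!: qball_sets[OF B])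
    also have "\<dots> \<le> emeasure N (qball X d x (2 * K * r))"
      using sub x FX K_ge_1 \<epsilon> by (intro emeasure_mono qball_sets[OF B]) auto
    also have "\<dots> \<le> ennreal (C1 * (2 * K * r) powr s)"
      using C1 x K_ge_1 \<epsilon> by auto
    finally have "real (card S) * (inverse c * \<delta> powr s) \<le> C1 * (2 * K * r) powr s"
      using C1 by (subst (asm) ennreal_le_iff) auto
    then have "real (card S) \<le> c * C1 * ((2 * K * r) powr s / \<delta> powr s)"
      using c \<delta> by (simp add: field_simps)
    also have "(2 * K * r) powr s / \<delta> powr s = (4 * K\<^sup>2 * (r / \<epsilon>)) powr s"
      using K_ge_1 \<epsilon> by (subst powr_divide[symmetric])
        (auto simp: \<delta>_def power2_eq_square field_simps)
    also have "\<dots> = (4 * K\<^sup>2) powr s * (r / \<epsilon>) powr s"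
      using \<epsilon> by (intro powr_mult)
    also have "c * C1 * ((4 * K\<^sup>2) powr s * (r / \<epsilon>) powr s) \<le> C * (r / \<epsilon>) powr s"
      by (auto simp: C_def mult.assoc[symmetric] intro!: mult_right_mono)
    finally show ?thesis .
  qed
  moreover have "1 \<le> C" by (simp add: C_def)
  ultimately show ?thesis using that by blast
next
  case False
  have FX: "F \<subseteq> X" using A by (auto simp: ahlfors_in_def)
  have single: "u = v" if uv: "u \<in> F" "v \<in> F" for u v
  proof -
    have "ereal (d u v) \<le> 0" using le_qdiam[OF uv] False by (meson not_less order_trans)
    then show ?thesis using nonneg[of u v] zero_iff[of u v] uv FX by auto
  qed
  have "real (card S) \<le> 1 * (r / \<epsilon>) powr s"
    if "0 < \<epsilon>" "\<epsilon> \<le> r" "S \<subseteq> F \<inter> qball X d x r" "separated \<epsilon> S" for x r \<epsilon> S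
  proof -
    have "card S \<le> 1" using that single
      by (auto simp: separated_def card_le_Suc0_iff_eq)
    moreover have "1 \<le> (r / \<epsilon>) powr s" using that s by (auto simp: ge_one_powr_ge_zero)
    ultimately show ?thesis by simp
  qed
  then show ?thesis by (intro that[of 1]) (simp_all only: order_refl)
qed

text \<open>
  A maximal \<open>\<epsilon>\<close>-separated subset \<open>S\<close> of \<open>F\<close> within \<open>B(z, 2 K R)\<close> exists because cardinalities are
  bounded, and it is \<open>\<epsilon>\<close>-dense there.  A point \<open>y\<close> of the tube is within \<open>\<epsilon>\<close> of some \<open>u \<in> F\<close>, and
  \<open>u\<close> is within \<open>\<epsilon>\<close> of \<open>S\<close>, so the balls of radius \<open>2 K \<epsilon>\<close> around \<open>S\<close> cover the tube.
\<close>

lemma tube_measure: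
  assumes pack: "\<And>x r \<epsilon> S. \<lbrakk>x \<in> F; 0 < \<epsilon>; \<epsilon> \<le> r; S \<subseteq> F \<inter> qball X d x r; separated \<epsilon> S\<rbrakk> \<Longrightarrow>
       real (card S) \<le> Cp * (r / \<epsilon>) powr s"
    and upper: "\<And>x r. \<lbrakk>x \<in> X; 0 < r\<rbrakk> \<Longrightarrow> emeasure M (qball X d x r) \<le> ennreal (Cu * r powr \<alpha>)"
    and Cu: "0 < Cu" and B: "borel_measure_on X d M" and F: "F \<subseteq> X" "F \<noteq> {}"
    and z: "z \<in> F" and \<epsilon>: "0 < \<epsilon>" "\<epsilon> \<le> R"
  shows "emeasure M {y \<in> qball X d z R. qsetdist d F y < \<epsilon>}
     \<le> ennreal (Cp * Cu * (2 * K) powr (s + \<alpha>) * \<epsilon> powr (\<alpha> - s) * R powr s)"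
proof -
  define P where "P S \<longleftrightarrow> S \<subseteq> F \<inter> qball X d z (2 * K * R) \<and> separated \<epsilon> S" for S
  have R: "0 < R" "R \<le> 2 * K * R" using \<epsilon> K_ge_1 by auto
  have card_le: "real (card S) \<le> Cp * (2 * K * R / \<epsilon>) powr s" if "P S" for S
    using that \<epsilon>(1) order_trans[OF \<epsilon>(2) R(2)] by (intro pack[OF z]) (simp_all add: P_def)
  have "P {}" by (simp add: P_def separated_def)
  moreover have "\<forall>S. P S \<longrightarrow> card S < nat \<lfloor>Cp * (2 * K * R / \<epsilon>) powr s\<rfloor> + 1"
    using le_nat_floor[OF card_le] by (auto intro: le_imp_less_Suc)
  ultimately obtain S where S: "P S" and max: "\<And>T. P T \<Longrightarrow> card T \<le> card S"
    using Lattices_Big.ex_has_greatest_nat[of P "{}" card] by blast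
  have SX: "S \<subseteq> X" "finite S" using S F by (auto simp: P_def separated_def)
  have cover: "{y \<in> qball X d z R. qsetdist d F y < \<epsilon>} \<subseteq> (\<Union>v\<in>S. qball X d v (2 * K * \<epsilon>))"
  proof clarify
    fix y assume y: "y \<in> qball X d z R" "qsetdist d F y < \<epsilon>"
    have yX: "y \<in> X" using y by (simp add: qball_def)
    obtain u where u: "u \<in> F" "d y u < \<epsilon>" using y yX qsetdist_less_iff[OF F] by blast
    have uX: "u \<in> X" using u F by blast
    have "\<exists>v\<in>S. d v u < \<epsilon>"
    proof (rule ccontr)
      assume far: "\<not> ?thesis"
      have "d z u < K * (R + \<epsilon>)"
        using y yX u uX z F by (intro triangle_less[where z = y]) (auto simp: qball_def)
      also have "\<dots> \<le> K * (R + R)" using \<epsilon> K_ge_1 by (intro mult_left_mono) auto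
      finally have "u \<in> qball X d z (2 * K * R)" using uX by (simp add: qball_def)
      moreover have "\<epsilon> \<le> d v u" "\<epsilon> \<le> d u v" if "v \<in> S" for v
        using that far SX uX sym[of u v] by (auto simp: not_less)
      ultimately have "P (insert u S)"
        using S u(1) by (simp add: P_def separated_def)
      moreover have "u \<notin> S" using far uX zero_iff[of u u] \<epsilon> by auto
      ultimately show False using max[of "insert u S"] SX by simp
    qed
    then obtain v where v: "v \<in> S" "d v u < \<epsilon>" by blast
    have "d v y < K * (\<epsilon> + \<epsilon>)"
      using v u y yX uX SX sym by (intro triangle_less[where z = u]) auto
    then show "y \<in> (\<Union>v\<in>S. qball X d v (2 * K * \<epsilon>))"
      using v yX by (auto simp: qball_def mult.assoc mult.left_commute[of K 2])
  qed
  have K\<epsilon>: "0 < 2 * K * \<epsilon>" using \<epsilon> K_ge_1 by simp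
  have "emeasure M {y \<in> qball X d z R. qsetdist d F y < \<epsilon>}
      \<le> emeasure M (\<Union>v\<in>S. qball X d v (2 * K * \<epsilon>))"
    using SX K\<epsilon> by (intro emeasure_mono[OF cover] sets.finite_UN qball_sets[OF B]) auto
  also have "\<dots> \<le> (\<Sum>v\<in>S. emeasure M (qball X d v (2 * K * \<epsilon>)))"
    using SX K\<epsilon> by (intro emeasure_subadditive_finite) (auto intro!: qball_sets[OF B])
  also have "\<dots> \<le> (\<Sum>v\<in>S. ennreal (Cu * (2 * K * \<epsilon>) powr \<alpha>))"
    using SX K\<epsilon> by (intro sum_mono upper) auto
  also have "\<dots> = ennreal (real (card S) * (Cu * (2 * K * \<epsilon>) powr \<alpha>))"
    using Cu by (simp add: ennreal_mult ennreal_of_nat_eq_real_of_nat)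
  also have "\<dots> \<le> ennreal (Cp * (2 * K * R / \<epsilon>) powr s * (Cu * (2 * K * \<epsilon>) powr \<alpha>))"
    using card_le[OF S] Cu by (intro ennreal_leI mult_right_mono) auto
  also have "Cp * (2 * K * R / \<epsilon>) powr s * (Cu * (2 * K * \<epsilon>) powr \<alpha>)
      = Cp * Cu * (2 * K) powr (s + \<alpha>) * \<epsilon> powr (\<alpha> - s) * R powr s"
    using K_ge_1 \<epsilon> R by (simp add: powr_mult powr_divide powr_add powr_diff)
  finally show ?thesis .
qed

section \<open>Integrals of powers of the distance\<close>

text \<open>
  For \<open>b \<ge> 0\<close> the upper bound \<open>K (f x + r)\<close> for the distance \<open>f\<close> on the ball suffices.
  For \<open>b < 0\<close> a ball with \<open>2 K r \<le> f x\<close> is far from \<open>F\<close>, and the distance is at least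
  \<open>(f x + r) / (4 K)\<close> on it.  Otherwise the ball is contained in one of radius \<open>3 K\<^sup>2 r\<close> centred at
  a point of \<open>F\<close>, where the tube estimate applies; it is there that the lower bound on the measure
  is used, to convert \<open>r\<^sup>\<alpha>\<close> into the measure of the ball.
\<close>

lemma distance_power_integral:
  assumes B: "borel_measure_on X d M" and F: "F \<subseteq> X" "F \<noteq> {}"
    and tube: "\<And>z \<epsilon> R. \<lbrakk>z \<in> F; 0 < \<epsilon>; \<epsilon> \<le> R\<rbrakk> \<Longrightarrow>
      emeasure M {y \<in> qball X d z R. qsetdist d F y < \<epsilon>}
        \<le> ennreal (Ct * \<epsilon> powr (\<alpha> - s) * R powr s)"
    and Ct: "0 \<le> Ct" and b: "s - \<alpha> < b" and c: "0 < c"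
  obtains C where "0 \<le> C"
    "\<And>x r. \<lbrakk>x \<in> X; 0 < r; ennreal (c * r powr \<alpha>) \<le> emeasure M (qball X d x r)\<rbrakk> \<Longrightarrow>
      (\<integral>\<^sup>+y\<in>qball X d x r. epow (ennreal (qsetdist d F y)) b \<partial>M)
        \<le> ennreal (C * (qsetdist d F x + r) powr b) * emeasure M (qball X d x r)"
proof -
  let ?f = "qsetdist d F"
  have bounded: "(\<integral>\<^sup>+y\<in>qball X d x r. epow (ennreal (?f y)) b \<partial>M)
        \<le> ennreal e * emeasure M (qball X d x r)"
    if "x \<in> X" "0 < r" "\<And>y. y \<in> qball X d x r \<Longrightarrow> epow (ennreal (?f y)) b \<le> ennreal e" for x r e
  proof -
    have "(\<integral>\<^sup>+y\<in>qball X d x r. epow (ennreal (?f y)) b \<partial>M)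
        \<le> (\<integral>\<^sup>+y\<in>qball X d x r. ennreal e \<partial>M)"
      using that(3) by (intro nn_integral_mono) (auto simp: indicator_def)
    also have "\<dots> = ennreal e * emeasure M (qball X d x r)"
      using that by (intro nn_integral_cmult_indicator qball_sets[OF B])
    finally show ?thesis .
  qed
  show ?thesis
  proof (cases "0 \<le> b")
    case True
    show ?thesis
    proof (rule that[of "K powr b"])
      fix x and r :: real assume x: "x \<in> X" and r: "0 < r"
      have \<rho>: "0 < ?f x + r" using qsetdist_nonneg[OF F x] r by simp
      have "epow (ennreal (?f y)) b \<le> ennreal (K powr b * (?f x + r) powr b)"
        if y: "y \<in> qball X d x r" for y
      proof -
        have yX: "y \<in> X" "d y x < r" using y sym x by (auto simp: qball_def)
        have "?f y \<le> K * (d y x + ?f x)" by (rule qsetdist_quasi_lipschitz[OF F x yX(1)])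
        also have "\<dots> \<le> K * (?f x + r)" using yX K_ge_1 by (intro mult_left_mono) auto
        finally have "epow (ennreal (?f y)) b \<le> ennreal ((K * (?f x + r)) powr b)"
          using \<rho> K_ge_1 True by (intro epow_le_nonneg) auto
        then show ?thesis using \<rho> K_ge_1 by (simp add: powr_mult)
      qed
      then show "(\<integral>\<^sup>+y\<in>qball X d x r. epow (ennreal (?f y)) b \<partial>M)
          \<le> ennreal (K powr b * (?f x + r) powr b) * emeasure M (qball X d x r)"
        using x r by (intro bounded)
    qed simp
  next
    case False
    define L where "L = Ct * (2 powr - b / (1 - 2 powr - (\<alpha> - s + b)))"
    have "2 powr - (\<alpha> - s + b) \<le> (2::real) powr 0" using b by (intro powr_mono) auto
    then have L: "0 \<le> L" using Ct unfolding L_def by (intro mult_nonneg_nonneg divide_nonneg_nonneg) auto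
    define C1 where "C1 = (1 / (4 * K)) powr b"
    define C2 where "C2 = L * (3 * K\<^sup>2) powr (\<alpha> + b) / c * (1 / (3 * K)) powr b"
    have C12: "0 \<le> C1" "0 \<le> C2" using L c by (auto simp: C1_def C2_def)
    show ?thesis
    proof (rule that[of "C1 + C2"])
      fix x and r :: real assume x: "x \<in> X" and r: "0 < r"
        and lower: "ennreal (c * r powr \<alpha>) \<le> emeasure M (qball X d x r)"
      define \<rho> where "\<rho> = ?f x + r"
      have fx: "0 \<le> ?f x" using qsetdist_nonneg[OF F x] .
      have \<rho>: "0 < \<rho>" using fx r by (simp add: \<rho>_def)
      have "\<exists>C\<in>{C1, C2}. (\<integral>\<^sup>+y\<in>qball X d x r. epow (ennreal (?f y)) b \<partial>M)
          \<le> ennreal (C * \<rho> powr b) * emeasure M (qball X d x r)"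
      proof (cases "2 * K * r \<le> ?f x")
        case True
        have "epow (ennreal (?f y)) b \<le> ennreal (C1 * \<rho> powr b)"
          if y: "y \<in> qball X d x r" for y
        proof -
          have yX: "y \<in> X" "d x y < r" using y by (auto simp: qball_def)
          have "?f x \<le> K * (d x y + ?f y)" by (rule qsetdist_quasi_lipschitz[OF F yX(1) x])
          also have "\<dots> \<le> K * (r + ?f y)" using yX K_ge_1 by (intro mult_left_mono) auto
          finally have 1: "?f x \<le> K * r + K * ?f y" by (simp add: algebra_simps)
          have "r \<le> K * r" using K_ge_1 r by simp
          then have "\<rho> \<le> 4 * K * ?f y" using 1 True r unfolding \<rho>_def by linarith
          then have "1 / (4 * K) * \<rho> \<le> ?f y" using K_ge_1 by (simp add: field_simps)
          then have "epow (ennreal (?f y)) b \<le> ennreal ((1 / (4 * K) * \<rho>) powr b)"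
            using \<rho> K_ge_1 False by (intro epow_le_nonpos) auto
          then show ?thesis unfolding C1_def by (simp only: powr_mult)
        qed
        then show ?thesis using bounded[OF x r] by blast
      next
        case near: False
        then obtain z where z: "z \<in> F" "d x z < 2 * K * r"
          using qsetdist_less_iff[OF F x] by (auto simp: not_le)
        have zX: "z \<in> X" using z F by blast
        define R where "R = 3 * K\<^sup>2 * r"
        have R: "0 < R" using r K_ge_1 by (simp add: R_def)
        have sub: "qball X d x r \<subseteq> qball X d z R"
        proof
          fix y assume y: "y \<in> qball X d x r"
          have "d z y < K * (2 * K * r + r)"
            using y z zX x sym by (intro triangle_less[where z = x]) (auto simp: qball_def)
          also have "\<dots> \<le> K * (2 * K * r + K * r)"
            using K_ge_1 r by (intro mult_left_mono add_left_mono) auto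
          also have "\<dots> = R" by (simp add: R_def power2_eq_square algebra_simps)
          finally show "y \<in> qball X d z R" using y by (simp add: qball_def)
        qed
        have less: "?f y < R" if "y \<in> qball X d z R" for y
          using that qsetdist_less_iff[OF F] sym zX z(1) by (auto simp: qball_def)
        have "(\<integral>\<^sup>+y\<in>qball X d x r. epow (ennreal (?f y)) b \<partial>M)
            \<le> (\<integral>\<^sup>+y\<in>qball X d z R. epow (ennreal (?f y)) b \<partial>M)"
          using sub by (intro nn_integral_mono) (auto simp: indicator_def)
        also have "\<dots> \<le> ennreal (Ct * R powr s * (2 powr - b / (1 - 2 powr - (\<alpha> - s + b)))
            * R powr (\<alpha> - s + b))"
          using tube[OF z(1)] Ct b False R less
          by (intro negative_power_integral qsetdist_measurable[OF B F] qball_sets[OF B zX])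
            (auto simp: mult.assoc mult.commute[of "R powr s"])
        also have "Ct * R powr s * (2 powr - b / (1 - 2 powr - (\<alpha> - s + b))) * R powr (\<alpha> - s + b)
            = L * R powr (\<alpha> + b)"
          using powr_add[of R s "\<alpha> - s + b"] by (simp add: L_def)
        also have "\<dots> = (L * (3 * K\<^sup>2) powr (\<alpha> + b) / c * r powr b) * (c * r powr \<alpha>)"
          using c by (simp add: R_def powr_mult powr_add)
        also have "ennreal \<dots> \<le> ennreal (C2 * \<rho> powr b * (c * r powr \<alpha>))"
        proof (intro ennreal_leI mult_right_mono)
          have "r \<le> K * r" using K_ge_1 r by simp
          then have "1 / (3 * K) * \<rho> \<le> r"
            using near K_ge_1 unfolding \<rho>_def by (simp add: field_simps)
          then have "r powr b \<le> (1 / (3 * K) * \<rho>) powr b"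
            using \<rho> K_ge_1 False by (intro powr_mono2') auto
          then show "L * (3 * K\<^sup>2) powr (\<alpha> + b) / c * r powr b \<le> C2 * \<rho> powr b"
            using L c unfolding C2_def powr_mult mult.assoc by (intro mult_left_mono) auto
        qed (use c in auto)
        also have "\<dots> = ennreal (C2 * \<rho> powr b) * ennreal (c * r powr \<alpha>)"
          using C12 c by (intro ennreal_mult) auto
        also have "\<dots> \<le> ennreal (C2 * \<rho> powr b) * emeasure M (qball X d x r)"
          using lower by (intro mult_left_mono) auto
        finally show ?thesis by blast
      qed
      then obtain C where C: "C \<in> {C1, C2}"
          "(\<integral>\<^sup>+y\<in>qball X d x r. epow (ennreal (?f y)) b \<partial>M)
            \<le> ennreal (C * \<rho> powr b) * emeasure M (qball X d x r)" by blast
      have "ennreal (C * \<rho> powr b) \<le> ennreal ((C1 + C2) * \<rho> powr b)"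
        using C(1) C12 by (intro ennreal_leI mult_right_mono) auto
      then show "(\<integral>\<^sup>+y\<in>qball X d x r. epow (ennreal (?f y)) b \<partial>M)
          \<le> ennreal ((C1 + C2) * (?f x + r) powr b) * emeasure M (qball X d x r)"
        using C(2) unfolding \<rho>_def by (meson mult_right_mono order_trans zero_le)
    qed (use C12 in simp)
  qed
qed


section \<open>From averages to Muckenhoupt conditions\<close>

text \<open>
  The length \<open>\<rho> x r\<close> is fixed before the exponent: the \<open>A\<^sub>p\<close> condition needs the averages for two
  exponents to be bounded by powers of the same number.
\<close>

definition averages_bounded ::
  "'a measure \<Rightarrow> ('a \<Rightarrow> real) \<Rightarrow> ('a \<Rightarrow> real \<Rightarrow> real) \<Rightarrow> real \<Rightarrow> bool" where
  "averages_bounded M f \<rho> b \<longleftrightarrow> (\<exists>C\<ge>0. \<forall>x\<in>X. \<forall>r>0.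
     average M (qball X d x r) (\<lambda>y. epow (ennreal (f y)) b) \<le> ennreal (C * \<rho> x r powr b))"

lemma averages_bounded_weight:
  assumes av: "averages_bounded M f \<rho> b" and f [measurable]: "f \<in> borel_measurable M"
    and fin: "\<And>x r. \<lbrakk>x \<in> X; 0 < r\<rbrakk> \<Longrightarrow> emeasure M (qball X d x r) < \<infinity>"
  shows "weight X d M (\<lambda>x. epow (ennreal (f x)) b)"
  unfolding weight_def
proof (intro conjI ballI allI impI)
  show "(\<lambda>x. epow (ennreal (f x)) b) \<in> borel_measurable M" by measurable
  fix x and r :: real assume x: "x \<in> X" "0 < r"
  obtain C where "average M (qball X d x r) (\<lambda>y. epow (ennreal (f y)) b) \<le> ennreal (C * \<rho> x r powr b)"
    using av x unfolding averages_bounded_def by blast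
  then have finite: "average M (qball X d x r) (\<lambda>y. epow (ennreal (f y)) b) \<noteq> top"
    by (metis ennreal_neq_top top_unique)
  show "(\<integral>\<^sup>+y\<in>qball X d x r. epow (ennreal (f y)) b \<partial>M) < \<infinity>"
  proof (rule ccontr)
    assume "\<not> ?thesis"
    then have "(\<integral>\<^sup>+y\<in>qball X d x r. epow (ennreal (f y)) b \<partial>M) = top"
      by (simp add: not_less top_unique)
    then show False
      using fin[OF x] finite by (simp add: average_def ennreal_top_divide less_top split: if_splits)
  qed
qed

text \<open>On a ball \<open>f \<le> \<kappa> \<rho>\<close>, so for \<open>b \<le> 0\<close> the average, at most \<open>C \<rho>\<^sup>b\<close>, is at most a multiple of \<open>f\<^sup>b\<close>
  at each point of the ball.\<close>

lemma averages_bounded_A1: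
  assumes av: "averages_bounded M f \<rho> b" and b: "b \<le> 0"
    and w: "weight X d M (\<lambda>x. epow (ennreal (f x)) b)"
    and \<rho>: "\<And>x r. \<lbrakk>x \<in> X; 0 < r\<rbrakk> \<Longrightarrow> 0 < \<rho> x r"
    and le: "\<And>x r y. \<lbrakk>x \<in> X; 0 < r; y \<in> qball X d x r\<rbrakk> \<Longrightarrow> f y \<le> \<kappa> * \<rho> x r" and \<kappa>: "0 < \<kappa>"
  shows "muckenhoupt_A1 X d M (\<lambda>x. epow (ennreal (f x)) b)"
proof -
  obtain C where C: "0 \<le> C" "\<And>x r. \<lbrakk>x \<in> X; 0 < r\<rbrakk> \<Longrightarrow>
      average M (qball X d x r) (\<lambda>y. epow (ennreal (f y)) b) \<le> ennreal (C * \<rho> x r powr b)"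
    using av unfolding averages_bounded_def by blast
  have "average M (qball X d x r) (\<lambda>y. epow (ennreal (f y)) b)
      \<le> ennreal (C * \<kappa> powr - b) * epow (ennreal (f y)) b"
    if x: "x \<in> X" "0 < r" and y: "y \<in> qball X d x r" for x r y
  proof -
    have "C * \<rho> x r powr b = C * \<kappa> powr - b * (\<kappa> * \<rho> x r) powr b"
      using \<kappa> by (simp add: powr_mult powr_minus)
    also have "ennreal \<dots> = ennreal (C * \<kappa> powr - b) * ennreal ((\<kappa> * \<rho> x r) powr b)"
      using C(1) by (intro ennreal_mult) auto
    also have "\<dots> \<le> ennreal (C * \<kappa> powr - b) * epow (ennreal (f y)) b"
      using le[OF x y] b \<kappa> \<rho>[OF x] by (intro mult_left_mono le_epow_nonpos) auto
    finally show ?thesis using C(2)[OF x] by order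
  qed
  then show ?thesis
    unfolding muckenhoupt_A1_def using w by blast
qed

text \<open>The second average, raised to the power \<open>p - 1\<close>, is at most a multiple of \<open>\<rho>\<close> to the power \<open>- \<beta>\<close>,
  and this cancels the bound for the first.\<close>

lemma averages_bounded_Ap:
  assumes av: "averages_bounded M f \<rho> \<beta>" "averages_bounded M f \<rho> (\<beta> * (- 1 / (p - 1)))"
    and w: "weight X d M (\<lambda>x. epow (ennreal (f x)) \<beta>)" and p: "1 < p"
    and \<rho>: "\<And>x r. \<lbrakk>x \<in> X; 0 < r\<rbrakk> \<Longrightarrow> 0 < \<rho> x r"
  shows "muckenhoupt_Ap p X d M (\<lambda>x. epow (ennreal (f x)) \<beta>)"
proof -
  define b where "b = \<beta> * (- 1 / (p - 1))"
  obtain C where C: "0 \<le> C" "\<And>x r. \<lbrakk>x \<in> X; 0 < r\<rbrakk> \<Longrightarrow>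
      average M (qball X d x r) (\<lambda>y. epow (ennreal (f y)) \<beta>) \<le> ennreal (C * \<rho> x r powr \<beta>)"
    using av(1) unfolding averages_bounded_def by blast
  obtain C' where C': "0 \<le> C'" "\<And>x r. \<lbrakk>x \<in> X; 0 < r\<rbrakk> \<Longrightarrow>
      average M (qball X d x r) (\<lambda>y. epow (ennreal (f y)) b) \<le> ennreal (C' * \<rho> x r powr b)"
    using av(2) unfolding averages_bounded_def b_def by blast
  have "average M (qball X d x r) (\<lambda>y. epow (ennreal (f y)) \<beta>) *
      epow (average M (qball X d x r) (\<lambda>y. epow (epow (ennreal (f y)) \<beta>) (- 1 / (p - 1)))) (p - 1)
      \<le> ennreal (C * (C' + 1) powr (p - 1))" if x: "x \<in> X" "0 < r" for x r
  proof -
    note \<rho>x = \<rho>[OF x]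
    have "average M (qball X d x r) (\<lambda>y. epow (epow (ennreal (f y)) \<beta>) (- 1 / (p - 1)))
        = average M (qball X d x r) (\<lambda>y. epow (ennreal (f y)) b)"
      by (simp add: epow_epow b_def)
    also have "\<dots> \<le> ennreal (C' * \<rho> x r powr b)" using C'(2)[OF x] .
    \<comment> \<open>A strictly positive constant, since \<open>epow_le_ennreal\<close> requires a positive bound.\<close>
    also have "\<dots> \<le> ennreal ((C' + 1) * \<rho> x r powr b)"
      by (intro ennreal_leI mult_right_mono) auto
    finally have "epow (average M (qball X d x r)
          (\<lambda>y. epow (epow (ennreal (f y)) \<beta>) (- 1 / (p - 1)))) (p - 1)
        \<le> ennreal (((C' + 1) * \<rho> x r powr b) powr (p - 1))"
      using C'(1) \<rho>x p by (intro epow_le_ennreal) auto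
    also have "((C' + 1) * \<rho> x r powr b) powr (p - 1) = (C' + 1) powr (p - 1) * \<rho> x r powr - \<beta>"
      using p by (simp add: powr_mult powr_powr b_def)
    finally have "epow (average M (qball X d x r)
          (\<lambda>y. epow (epow (ennreal (f y)) \<beta>) (- 1 / (p - 1)))) (p - 1)
        \<le> ennreal ((C' + 1) powr (p - 1) * \<rho> x r powr - \<beta>)" .
    note mult_mono[OF C(2)[OF x] this]
    also have "ennreal (C * \<rho> x r powr \<beta>) * ennreal ((C' + 1) powr (p - 1) * \<rho> x r powr - \<beta>)
        = ennreal (C * (C' + 1) powr (p - 1))"
      using C(1) \<rho>x by (simp add: ennreal_mult[symmetric] powr_minus)
    finally show ?thesis by simp
  qed
  then show ?thesis
    unfolding muckenhoupt_Ap_def using w by blast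
qed

text \<open>A space of diameter zero is a single point, which would be an atom.\<close>

lemma qdiam_pos:
  assumes B: "borel_measure_on X d M" and na: "non_atomic X M"
    and x: "x \<in> X" and pos: "0 < emeasure M (qball X d x 1)"
  shows "0 < qdiam d X"
proof (rule ccontr)
  assume small: "\<not> ?thesis"
  have "y = x" if "y \<in> X" for y
  proof -
    have "ereal (d x y) \<le> 0" using le_qdiam[OF x that] small by (meson not_less order_trans)
    then show ?thesis using nonneg[OF x that] zero_iff[OF x that] by simp
  qed
  then have "qball X d x 1 \<subseteq> {x}" by (auto simp: qball_def)
  moreover have "{x} \<in> null_sets M" using na x by (simp add: non_atomic_def)
  ultimately have "qball X d x 1 \<in> null_sets M"
    using qball_sets[OF B x, of 1] by (metis null_sets_subset zero_less_one)
  then show False using pos by (simp add: null_sets_def)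
qed

end

lemma quasi_metric_exists:
  assumes qd: "quasi_distance X d" and "balls_open X d"
  obtains K where "quasi_metric X d K"
proof -
  have sep: "\<forall>x\<in>X. \<forall>y\<in>X. 0 \<le> d x y \<and> d x y = d y x \<and> (d x y = 0 \<longleftrightarrow> x = y)"
    and tri: "\<exists>K\<ge>1. \<forall>x\<in>X. \<forall>y\<in>X. \<forall>z\<in>X. d x y \<le> K * (d x z + d z y)"
    using qd unfolding quasi_distance_def by (rule conjunct1, rule conjunct2)
  obtain K where K: "1 \<le> K" "\<And>x y z. \<lbrakk>x \<in> X; y \<in> X; z \<in> X\<rbrakk> \<Longrightarrow> d x y \<le> K * (d x z + d z y)"
    using tri by blast
  have "0 \<le> d x y" "d x y = d y x" "d x y = 0 \<longleftrightarrow> x = y" if "x \<in> X" "y \<in> X" for x y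
    using bspec[OF bspec[OF sep that(1)] that(2)] by - (elim conjE, assumption)+
  then have "quasi_metric X d K"
    by (rule quasi_metric.intro[OF _ _ _ K assms(2)])
  then show ?thesis by (rule that)
qed

lemma homogeneous_type_ball:
  assumes "homogeneous_type X d M" "x \<in> X" "0 < r"
  shows "0 < emeasure M (qball X d x r)" "emeasure M (qball X d x r) < \<infinity>"
proof -
  have "0 < emeasure M (qball X d x (2 * (r / 2)))"
    using assms half_gt_zero[OF assms(3)] unfolding homogeneous_type_def by blast
  then show "0 < emeasure M (qball X d x r)" by simp
  show "emeasure M (qball X d x r) < \<infinity>"
    using assms unfolding homogeneous_type_def by blast
qed

theorem theorem7:
  fixes X F :: "'a set" and d :: "'a \<Rightarrow> 'a \<Rightarrow> real" and \<mu> \<nu> :: "'a measure" and \<alpha> s :: real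
  assumes "quasi_distance X d" and "balls_open X d"
    and "ahlfors_in X d X \<alpha> \<mu>"
    and "homogeneous_type X d \<mu>" and "non_atomic X \<mu>"
    and "closedin (qtopology X d) F" and "F \<noteq> {}"
    and "ahlfors_in X d F s \<nu>"
    and "0 \<le> s" and "s < \<alpha>"
  shows "(\<forall>\<gamma>. 0 \<le> \<gamma> \<and> \<gamma> < 1 \<longrightarrow>
            muckenhoupt_A1 X d \<mu> (\<lambda>x. epow (ennreal (qsetdist d F x)) (\<gamma> * (s - \<alpha>)))) \<and>
         (\<forall>p \<beta>. 1 < p \<and> - (\<alpha> - s) < \<beta> \<and> \<beta> < (\<alpha> - s) * (p - 1) \<longrightarrow>
            muckenhoupt_Ap p X d \<mu> (\<lambda>x. epow (ennreal (qsetdist d F x)) \<beta>))"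
proof -
  obtain K where "quasi_metric X d K"
    using quasi_metric_exists[OF assms(1,2)] .
  then interpret quasi_metric X d K .
  let ?f = "qsetdist d F" and ?B = "qball X d"
  have B: "borel_measure_on X d \<mu>" and F: "F \<subseteq> X" "F \<noteq> {}"
    using assms(3,7,8) by (auto simp: ahlfors_in_def)
  note pos = homogeneous_type_ball(1)[OF assms(4)] and fin = homogeneous_type_ball(2)[OF assms(4)]
  have diam: "0 < qdiam d X"
    using qdiam_pos[OF B assms(5)] pos F by (metis all_not_in_conv subsetD zero_less_one)
  have \<alpha>: "0 \<le> \<alpha>" using assms(9,10) by linarith
  obtain Cu where Cu: "0 < Cu"
    "\<And>x r. \<lbrakk>x \<in> X; 0 < r\<rbrakk> \<Longrightarrow> emeasure \<mu> (?B x r) \<le> ennreal (Cu * r powr \<alpha>)"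
    using ahlfors_upper[OF assms(3) \<alpha> diam] by blast
  obtain c where c: "0 < c" "\<And>x r. \<lbrakk>x \<in> X; 0 < r\<rbrakk> \<Longrightarrow>
     \<exists>r'>0. ?B x r = ?B x r' \<and> ennreal (c * r' powr \<alpha>) \<le> emeasure \<mu> (?B x r')"
    using ahlfors_lower_same_ball[OF assms(3) \<alpha> diam] by blast
  \<comment> \<open>The radius \<open>R x r\<close> describes the same ball as \<open>r\<close>, and at it the lower bound holds.\<close>
  obtain R where R: "\<And>x r. \<lbrakk>x \<in> X; 0 < r\<rbrakk> \<Longrightarrow>
     R x r > 0 \<and> ?B x r = ?B x (R x r) \<and> ennreal (c * R x r powr \<alpha>) \<le> emeasure \<mu> (?B x (R x r))"
    using c(2) by metis
  obtain Cp where Cp: "1 \<le> Cp"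
    "\<And>x r \<epsilon> S. \<lbrakk>x \<in> F; 0 < \<epsilon>; \<epsilon> \<le> r; S \<subseteq> F \<inter> ?B x r; separated \<epsilon> S\<rbrakk> \<Longrightarrow>
       real (card S) \<le> Cp * (r / \<epsilon>) powr s"
    using ahlfors_packing[OF assms(8,9)] by blast
  define Ct where "Ct = Cp * Cu * (2 * K) powr (s + \<alpha>)"
  have Ct: "0 \<le> Ct" using Cp(1) Cu(1) by (simp add: Ct_def)
  have tube: "emeasure \<mu> {y \<in> ?B z R. ?f y < \<epsilon>} \<le> ennreal (Ct * \<epsilon> powr (\<alpha> - s) * R powr s)"
    if "z \<in> F" "0 < \<epsilon>" "\<epsilon> \<le> R" for z \<epsilon> R
    unfolding Ct_def by (rule tube_measure[OF Cp(2) Cu(2,1) B F that])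
  define \<rho> where "\<rho> x r = ?f x + R x r" for x r
  have \<rho>: "0 < \<rho> x r" if "x \<in> X" "0 < r" for x r
    using qsetdist_nonneg[OF F that(1)] R[OF that] by (simp add: \<rho>_def)
  have f_le: "?f y \<le> K * \<rho> x r" if x: "x \<in> X" "0 < r" and y: "y \<in> ?B x r" for x r y
  proof -
    have yX: "y \<in> X" "d y x < R x r" using y R[OF x] sym x by (auto simp: qball_def)
    have "?f y \<le> K * (d y x + ?f x)" by (rule qsetdist_quasi_lipschitz[OF F x(1) yX(1)])
    also have "\<dots> \<le> K * \<rho> x r" using yX K_ge_1 unfolding \<rho>_def by (intro mult_left_mono) auto
    finally show ?thesis .
  qed
  have av: "averages_bounded \<mu> ?f \<rho> b" if b: "s - \<alpha> < b" for b
  proof -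
    obtain C where C: "0 \<le> C"
      "\<And>x r. \<lbrakk>x \<in> X; 0 < r; ennreal (c * r powr \<alpha>) \<le> emeasure \<mu> (?B x r)\<rbrakk> \<Longrightarrow>
      (\<integral>\<^sup>+y\<in>?B x r. epow (ennreal (?f y)) b \<partial>\<mu>)
        \<le> ennreal (C * (?f x + r) powr b) * emeasure \<mu> (?B x r)"
      using distance_power_integral[OF B F tube Ct b c(1)] by blast
    have "average \<mu> (?B x r) (\<lambda>y. epow (ennreal (?f y)) b) \<le> ennreal (C * \<rho> x r powr b)"
      if x: "x \<in> X" "0 < r" for x r
    proof -
      have "(\<integral>\<^sup>+y\<in>?B x r. epow (ennreal (?f y)) b \<partial>\<mu>)
          \<le> ennreal (C * \<rho> x r powr b) * emeasure \<mu> (?B x r)"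
        using C(2)[OF x(1), of "R x r"] R[OF x] by (simp add: \<rho>_def)
      then show ?thesis
        using pos[OF x] fin[OF x] unfolding average_def
        by (intro divide_le_posI_ennreal) (auto simp: mult.commute)
    qed
    with C(1) show ?thesis unfolding averages_bounded_def by blast
  qed
  note w = averages_bounded_weight[OF av qsetdist_measurable[OF B F] fin]
  show ?thesis
  proof (intro conjI allI impI)
    fix \<gamma> :: real assume \<gamma>: "0 \<le> \<gamma> \<and> \<gamma> < 1"
    have b: "s - \<alpha> < \<gamma> * (s - \<alpha>)" "\<gamma> * (s - \<alpha>) \<le> 0"
      using \<gamma> assms(10) mult_strict_right_mono[of \<gamma> 1 "\<alpha> - s"] mult_nonneg_nonpos[of \<gamma> "s - \<alpha>"]
      by (auto simp: algebra_simps)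
    show "muckenhoupt_A1 X d \<mu> (\<lambda>x. epow (ennreal (?f x)) (\<gamma> * (s - \<alpha>)))"
      using averages_bounded_A1[OF av[OF b(1)] b(2) w[OF b(1)] \<rho> f_le] K_ge_1 by simp
  next
    fix p \<beta> :: real assume p\<beta>: "1 < p \<and> - (\<alpha> - s) < \<beta> \<and> \<beta> < (\<alpha> - s) * (p - 1)"
    have b: "s - \<alpha> < \<beta>" "s - \<alpha> < \<beta> * (- 1 / (p - 1))" using p\<beta> by (auto simp: field_simps)
    show "muckenhoupt_Ap p X d \<mu> (\<lambda>x. epow (ennreal (?f x)) \<beta>)"
      using averages_bounded_Ap[OF av[OF b(1)] av[OF b(2)] w[OF b(1)] _ \<rho>] p\<beta> by blast
  qed
qed

end
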